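(* Let $q>1$ and $b\ge1$. The probability distribution $\tau\mapsto \prod_{i=1}^b(1-q^{-i})\,q^{-\ell(\tau)}$ on the set of $b$-ball juggling states is a stationary distribution of the backward juggling Markov chain with coin parameter $q$.
   Context: A $b$-ball juggling state is a $b$-element subset of $\mathbb{N}=\{0,1,2,\dots\}$, drawn as a word in $\times$ (positions in the subset) and $-$ (other positions). For a juggling state $\tau$, $\ell(\tau)$ is the number of pairs $i<j$ of positions with $i\notin\tau$ and $j\in\tau$. The backward juggling Markov chain acts on a state $\sigma$ as follows: flip a coin with probability of heads $1/q$ at most $b$ times, or until it comes up tails. If it never comes up tails, the new state is $\{s+1:s\in\sigma\}$. If it comes up tails first on the $i$th flip, let $x$ be the $i$th largest element of $\sigma$; the new state is $\{0\}\cup\{s+1: s\in\sigma\setminus\{x\}\}$. *)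

theory Defs
  imports "HOL-Probability.Probability"
begin

definition juggling_states :: "nat \<Rightarrow> nat set set" where
  "juggling_states b = {\<sigma>. finite \<sigma> \<and> card \<sigma> = b}"

definition ell :: "nat set \<Rightarrow> nat" where
  "ell \<tau> = card {(i, j). i < j \<and> i \<notin> \<tau> \<and> j \<in> \<tau>}"

text \<open>
  Flip a coin with probability \<open>p\<close> of heads at most \<open>n\<close> times, or until it comes up tails:
  \<open>Some i\<close> if the first tails is on the \<open>i\<close>-th flip (counting from 1), \<open>None\<close> if it never
  comes up tails. (True means heads.)
\<close>
primrec first_tails :: "real \<Rightarrow> nat \<Rightarrow> nat option pmf" where
  "first_tails p 0 = return_pmf None"
| "first_tails p (Suc n) = bind_pmf (bernoulli_pmf p)
     (\<lambda>heads. if heads then map_pmf (map_option Suc) (first_tails p n)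
              else return_pmf (Some 1))"

text \<open>The index counts from 1, so \<open>ith_largest \<sigma> 1\<close> is the maximum of \<open>\<sigma>\<close>.\<close>
definition ith_largest :: "nat set \<Rightarrow> nat \<Rightarrow> nat" where
  "ith_largest \<sigma> i = rev (sorted_list_of_set \<sigma>) ! (i - 1)"

definition backward_step :: "nat set \<Rightarrow> nat option \<Rightarrow> nat set" where
  "backward_step \<sigma> r = (case r of
      None \<Rightarrow> Suc ` \<sigma>
    | Some i \<Rightarrow> insert 0 (Suc ` (\<sigma> - {ith_largest \<sigma> i})))"

definition backward_chain :: "real \<Rightarrow> nat \<Rightarrow> nat set \<Rightarrow> nat set pmf" where
  "backward_chain q b \<sigma> = map_pmf (backward_step \<sigma>) (first_tails (1 / q) b)"

text \<open>
  \<open>K x\<close> is the law of the next state from \<open>x\<close>. The first conjunct says that \<open>K\<close> is a Markov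
  chain on \<open>S\<close>, the next two that \<open>\<pi>\<close> is a probability distribution on \<open>S\<close>; the values of
  \<open>\<pi>\<close> outside \<open>S\<close> are irrelevant.
\<close>
definition stationary_distribution_on ::
    "'a set \<Rightarrow> ('a \<Rightarrow> 'a pmf) \<Rightarrow> ('a \<Rightarrow> real) \<Rightarrow> bool" where
  "stationary_distribution_on S K \<pi> \<longleftrightarrow>
     (\<forall>x\<in>S. set_pmf (K x) \<subseteq> S) \<and>
     (\<forall>x\<in>S. 0 \<le> \<pi> x) \<and>
     (\<pi> has_sum 1) S \<and>
     (\<forall>y\<in>S. ((\<lambda>x. \<pi> x * pmf (K x) y) has_sum \<pi> y) S)"

end

theory Submission
  imports Defs
begin

text \<open>
  Put \<open>p = 1/q\<close>. A state \<open>Suc ` \<sigma>\<close> has \<open>\<sigma>\<close> as its only predecessor, reached with probability \<open>p ^ b\<close>,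
  and \<open>ell\<close> grows by exactly \<open>b\<close>. A state \<open>insert 0 (Suc ` \<rho>)\<close> has the predecessors \<open>insert x \<rho>\<close> with
  \<open>x \<notin> \<rho>\<close>; the transition probability \<open>p ^ a * (1 - p)\<close>, where \<open>a\<close> counts the elements of \<open>\<rho>\<close> above \<open>x\<close>,
  turns the weight \<open>p ^ ell (insert x \<rho>)\<close> into \<open>p ^ ell \<rho> * p ^ n * (1 - p)\<close>, where \<open>n\<close> counts the
  non-elements of \<open>\<rho>\<close> below \<open>x\<close>. As \<open>x\<close> varies, \<open>n\<close> takes every natural value once, so the geometric
  series gives \<open>p ^ ell \<rho>\<close>. Splitting off the minimum of a state makes the normalising constant a
  product of geometric series.
\<close>

section \<open>How \<open>ell\<close> changes when a state is shifted or gains an element\<close>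

definition gap_pairs :: "nat set \<Rightarrow> (nat \<times> nat) set" where
  "gap_pairs \<tau> = {(i, j). i < j \<and> i \<notin> \<tau> \<and> j \<in> \<tau>}"

lemma ell_eq_card_gap_pairs: "ell \<tau> = card (gap_pairs \<tau>)"
  by (simp add: ell_def gap_pairs_def)

lemma finite_gap_pairs: "finite \<tau> \<Longrightarrow> finite (gap_pairs \<tau>)"
  by (rule finite_subset[of _ "(\<Union>j\<in>\<tau>. {..<j}) \<times> \<tau>"]) (auto simp: gap_pairs_def)

text \<open>The shift keeps all old pairs and leaves position 0 empty; that gap lies below every
  ball, so it adds one pair per ball.\<close>

lemma ell_Suc_image:
  assumes "finite \<sigma>"
  shows "ell (Suc ` \<sigma>) = ell \<sigma> + card \<sigma>"
proof -
  have eq: "gap_pairs (Suc ` \<sigma>) = map_prod Suc Suc ` gap_pairs \<sigma> \<union> Pair 0 ` Suc ` \<sigma>"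
    (is "?L = ?R")
  proof (intro equalityI subsetI)
    fix z assume "z \<in> ?L"
    then obtain i j where z: "z = (i, Suc j)" "i < Suc j" "i \<notin> Suc ` \<sigma>" "j \<in> \<sigma>"
      by (auto simp: gap_pairs_def)
    then show "z \<in> ?R"
    proof (cases i)
      case 0 with z show ?thesis by auto
    next
      case (Suc k)
      with z have "(k, j) \<in> gap_pairs \<sigma>" by (auto simp: gap_pairs_def)
      then have "map_prod Suc Suc (k, j) \<in> map_prod Suc Suc ` gap_pairs \<sigma>" by (rule imageI)
      with z Suc show ?thesis by simp
    qed
  qed (auto simp: gap_pairs_def)
  have "card (map_prod Suc Suc ` gap_pairs \<sigma>) = ell \<sigma>"
    by (subst card_image) (auto simp: inj_on_def ell_eq_card_gap_pairs)
  moreover have "card (Pair 0 ` Suc ` \<sigma>) = card \<sigma>"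
    by (simp add: card_image inj_on_def)
  moreover have "map_prod Suc Suc ` gap_pairs \<sigma> \<inter> Pair 0 ` Suc ` \<sigma> = {}" by auto
  ultimately show ?thesis
    using assms by (simp add: ell_eq_card_gap_pairs eq card_Un_disjoint finite_gap_pairs)
qed

text \<open>An occupied position 0 is not a gap and has no gap below it, so it belongs to no
  pair.\<close>

lemma ell_insert_0: "ell (insert 0 (Suc ` \<rho>)) = ell \<rho>"
proof -
  have "gap_pairs (insert 0 (Suc ` \<rho>)) = map_prod Suc Suc ` gap_pairs \<rho>" (is "?L = ?R")
  proof (intro equalityI subsetI)
    fix z assume "z \<in> ?L"
    then obtain i j where ij: "z = (i, j)" "i < j" "i \<noteq> 0" "i \<notin> Suc ` \<rho>" "j \<in> Suc ` \<rho>"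
      by (auto simp: gap_pairs_def)
    then obtain k l where "i = Suc k" "j = Suc l" by (auto simp: gr0_conv_Suc)
    with ij have z: "z = (Suc k, Suc l)" "(k, l) \<in> gap_pairs \<rho>"
      by (auto simp: gap_pairs_def)
    then have "map_prod Suc Suc (k, l) \<in> map_prod Suc Suc ` gap_pairs \<rho>" by (intro imageI)
    with z show "z \<in> ?R" by simp
  qed (auto simp: gap_pairs_def)
  moreover have "card (map_prod Suc Suc ` gap_pairs \<rho>) = card (gap_pairs \<rho>)"
    by (rule card_image) (auto simp: inj_on_def)
  ultimately show ?thesis by (simp add: ell_eq_card_gap_pairs)
qed

text \<open>Filling the gap \<open>x\<close> destroys the pairs that start at \<open>x\<close> and
  creates those that end there. The additive form avoids subtraction, and its left side is the
  exponent of a weight times a transition probability.\<close>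

lemma ell_insert:
  assumes "finite \<rho>" "x \<notin> \<rho>"
  shows "ell (insert x \<rho>) + card {s \<in> \<rho>. x < s} = ell \<rho> + card {i. i < x \<and> i \<notin> \<rho>}"
proof -
  \<comment> \<open>\<open>?A\<close> holds the pairs that are lost, \<open>?B\<close> those that
    are gained.\<close>
  let ?A = "Pair x ` {s \<in> \<rho>. x < s}" and ?B = "(\<lambda>i. (i, x)) ` {i. i < x \<and> i \<notin> \<rho>}"
  have "gap_pairs (insert x \<rho>) \<union> ?A = gap_pairs \<rho> \<union> ?B"
    using assms by (auto simp: gap_pairs_def)
  moreover have "gap_pairs (insert x \<rho>) \<inter> ?A = {}" "gap_pairs \<rho> \<inter> ?B = {}"
    using assms by (auto simp: gap_pairs_def)
  moreover have "finite (gap_pairs (insert x \<rho>))" "finite (gap_pairs \<rho>)" "finite ?A" "finite ?B"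
    using assms by (auto intro: finite_gap_pairs)
  ultimately have "card (gap_pairs (insert x \<rho>)) + card ?A = card (gap_pairs \<rho>) + card ?B"
    by (simp only: card_Un_disjoint[symmetric])
  then show ?thesis
    by (simp add: ell_eq_card_gap_pairs card_image inj_on_def)
qed

section \<open>Ranking the elements of a state\<close>

lemma ith_largest_props:
  assumes "finite \<sigma>" "card \<sigma> = b"
  shows bij_betw_ith_largest: "bij_betw (ith_largest \<sigma>) {1..b} \<sigma>"
    and card_greater_ith_largest:
      "i \<in> {1..b} \<Longrightarrow> card {s \<in> \<sigma>. ith_largest \<sigma> i < s} = i - 1"
proof -
  \<comment> \<open>The list is strictly decreasing, so the elements above an entry are exactly
    those at smaller list positions; list positions start at 0, ranks at 1.\<close>
  define xs where "xs = rev (sorted_list_of_set \<sigma>)"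
  have xs: "distinct xs" "set xs = \<sigma>" "length xs = b" "sorted_wrt (>) xs"
    using assms strict_sorted_list_of_set[of \<sigma>] by (auto simp: xs_def sorted_wrt_rev)
  have ith: "ith_largest \<sigma> i = xs ! (i - 1)" for i
    by (simp add: ith_largest_def xs_def)
  have "bij_betw (\<lambda>i. i - 1) {1..b} {..<b}"
    by (rule bij_betw_byWitness[of _ Suc]) auto
  moreover have nth: "bij_betw ((!) xs) {..<b} \<sigma>"
    using xs by (intro bij_betw_nth) auto
  ultimately have "bij_betw ((!) xs \<circ> (\<lambda>i. i - 1)) {1..b} \<sigma>" by (rule bij_betw_trans)
  then show "bij_betw (ith_largest \<sigma>) {1..b} \<sigma>" by (simp add: ith[abs_def] o_def)
  assume i: "i \<in> {1..b}"
  have "{s \<in> \<sigma>. ith_largest \<sigma> i < s} = (!) xs ` {..<i - 1}" (is "?L = ?R")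
  proof (intro equalityI subsetI)
    fix s assume "s \<in> ?L"
    then obtain k where k: "k < b" "s = xs ! k" "xs ! (i - 1) < xs ! k"
      using xs by (auto simp: ith in_set_conv_nth)
    have "k < i - 1"
    proof (rule ccontr)
      assume "\<not> k < i - 1"
      then have "xs ! (i - 1) \<ge> xs ! k"
        using sorted_wrt_nth_less[OF xs(4), of "i - 1" k] k xs by (cases "k = i - 1") auto
      with k show False by simp
    qed
    with k show "s \<in> ?R" by auto
  next
    fix s assume "s \<in> ?R"
    then obtain k where "k < i - 1" "s = xs ! k" by auto
    then show "s \<in> ?L"
      using sorted_wrt_nth_less[OF xs(4), of k "i - 1"] i xs by (auto simp: ith)
  qed
  moreover have "inj_on ((!) xs) {..<i - 1}"
    using i by (intro inj_on_subset[OF bij_betw_imp_inj_on[OF nth]]) auto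
  ultimately show "card {s \<in> \<sigma>. ith_largest \<sigma> i < s} = i - 1"
    by (simp add: card_image)
qed

section \<open>Coin flips and transition probabilities\<close>

lemma pmf_map_option_Suc_Some:
  "pmf (map_pmf (map_option Suc) M) (Some (Suc i)) = pmf M (Some i)"
  using pmf_map_inj'[of "map_option Suc" M "Some i"] by (simp add: option.inj_map)

lemma pmf_map_option_Suc_None: "pmf (map_pmf (map_option Suc) M) None = pmf M None"
  using pmf_map_inj'[of "map_option Suc" M None] by (simp add: option.inj_map)

context
  fixes p :: real
  assumes p: "0 < p" "p < 1"
begin

text \<open>Both faces of the coin have positive probability, so every outcome occurs.\<close>

lemma set_pmf_first_tails: "set_pmf (first_tails p n) = insert None (Some ` {1..n})"
proof (induction n)
  case (Suc n)
  have "set_pmf (first_tails p (Suc n)) = insert (Some 1) (map_option Suc ` set_pmf (first_tails p n))"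
    using p by (auto simp: UNIV_bool)
  also have "\<dots> = insert None (Some ` insert 1 (Suc ` {1..n}))"
    by (simp add: Suc image_image insert_commute del: image_Suc_atLeastAtMost)
  also have "insert 1 (Suc ` {1..n}) = {1..Suc n}"
    by auto
  finally show ?case .
qed auto

lemma pmf_first_tails_None: "pmf (first_tails p n) None = p ^ n"
proof (induction n)
  case (Suc n)
  with p show ?case
    by (simp add: pmf_bind pmf_map_option_Suc_None)
qed auto

lemma pmf_first_tails_Some: "i < n \<Longrightarrow> pmf (first_tails p n) (Some (Suc i)) = p ^ i * (1 - p)"
proof (induction n arbitrary: i)
  case (Suc n)
  show ?case
  proof (cases i)
    case 0
    \<comment> \<open>After an initial head the first tails comes at flip 2 or later, so that branch
      contributes nothing.\<close>
    have "pmf (map_pmf (map_option Suc) (first_tails p n)) (Some (Suc 0)) = 0"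
      by (auto simp: pmf_eq_0_set_pmf set_pmf_first_tails)
    with 0 p show ?thesis by (simp add: pmf_bind)
  next
    case (Suc k)
    with Suc.IH[of k] Suc.prems p show ?thesis
      by (simp add: pmf_bind pmf_map_option_Suc_Some)
  qed
qed auto

text \<open>Whether 0 is occupied separates \<open>None\<close> from \<open>Some i\<close>, and the
  missing element determines \<open>i\<close>. Hence the probability of a transition is that of a
  single outcome. Only the support is considered, because \<open>ith_largest\<close> is meaningful
  only for ranks from 1 to \<open>b\<close>.\<close>

lemma inj_on_backward_step:
  assumes "\<sigma> \<in> juggling_states b"
  shows "inj_on (backward_step \<sigma>) (set_pmf (first_tails p b))"
proof -
  have bij: "bij_betw (ith_largest \<sigma>) {1..b} \<sigma>"
    using assms by (intro bij_betw_ith_largest) (auto simp: juggling_states_def)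
  have "i = j" if "i \<in> {1..b}" "j \<in> {1..b}"
    "insert 0 (Suc ` (\<sigma> - {ith_largest \<sigma> i})) = insert 0 (Suc ` (\<sigma> - {ith_largest \<sigma> j}))" for i j
  proof -
    have "\<sigma> - {ith_largest \<sigma> i} = \<sigma> - {ith_largest \<sigma> j}"
      using that(3) by (subst (asm) insert_ident) (auto simp: inj_image_eq_iff)
    moreover have "ith_largest \<sigma> i \<in> \<sigma>" "ith_largest \<sigma> j \<in> \<sigma>"
      using bij_betwE[OF bij] that by auto
    ultimately have "ith_largest \<sigma> i = ith_largest \<sigma> j" by blast
    then show "i = j" using bij_betw_imp_inj_on[OF bij] that by (auto dest: inj_onD)
  qed
  then show ?thesis
    unfolding set_pmf_first_tails inj_on_def backward_step_def
    by (auto split: option.splits)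
qed

lemma pmf_backward_step:
  assumes "\<sigma> \<in> juggling_states b" "r \<in> insert None (Some ` {1..b})"
  shows "pmf (map_pmf (backward_step \<sigma>) (first_tails p b)) (backward_step \<sigma> r)
       = pmf (first_tails p b) r"
  using assms by (intro pmf_map_inj inj_on_backward_step) (auto simp: set_pmf_first_tails)

lemma pmf_backward_shift:
  assumes "\<sigma> \<in> juggling_states b"
  shows "pmf (map_pmf (backward_step \<sigma>) (first_tails p b)) (Suc ` \<sigma>) = p ^ b"
  using pmf_backward_step[OF assms, of None]
  by (simp add: backward_step_def pmf_first_tails_None)

text \<open>If \<open>x\<close> has rank \<open>i\<close>, then \<open>i - 1\<close> elements lie
  above it, and removing it takes \<open>i - 1\<close> heads followed by tails.\<close>

lemma pmf_backward_insert:
  assumes "finite \<rho>" "x \<notin> \<rho>" "Suc (card \<rho>) = b"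
  shows "pmf (map_pmf (backward_step (insert x \<rho>)) (first_tails p b)) (insert 0 (Suc ` \<rho>))
       = p ^ card {s \<in> \<rho>. x < s} * (1 - p)"
proof -
  have st: "insert x \<rho> \<in> juggling_states b" "finite (insert x \<rho>)" "card (insert x \<rho>) = b"
    using assms by (auto simp: juggling_states_def)
  obtain i where i: "i \<in> {1..b}" "x = ith_largest (insert x \<rho>) i"
    using bij_betw_ith_largest[OF st(2,3)] by (metis bij_betw_iff_bijections insertI1)
  have "{s \<in> insert x \<rho>. x < s} = {s \<in> \<rho>. x < s}" by auto
  then have ic: "card {s \<in> \<rho>. x < s} = i - 1"
    using card_greater_ith_largest[OF st(2,3) i(1)] i(2) by simp
  have "backward_step (insert x \<rho>) (Some i) = insert 0 (Suc ` \<rho>)"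
    using assms(2) i(2)[symmetric] by (simp add: backward_step_def)
  then have "pmf (map_pmf (backward_step (insert x \<rho>)) (first_tails p b)) (insert 0 (Suc ` \<rho>))
      = pmf (first_tails p b) (Some i)"
    using pmf_backward_step[OF st(1), of "Some i"] i(1) by simp
  also have "\<dots> = p ^ (i - 1) * (1 - p)"
    using pmf_first_tails_Some[of "i - 1" b] i(1) by (cases i) auto
  finally show ?thesis by (simp add: ic)
qed

text \<open>Replacing the rank \<open>i\<close> by the remaining set \<open>\<rho>\<close> lets the
  predecessors of a given state be read off.\<close>

lemma backward_step_cases:
  assumes "\<sigma> \<in> juggling_states b" "\<tau> \<in> set_pmf (map_pmf (backward_step \<sigma>) (first_tails p b))"
  obtains "\<tau> = Suc ` \<sigma>"
    | x \<rho> where "\<sigma> = insert x \<rho>" "x \<notin> \<rho>" "finite \<rho>" "Suc (card \<rho>) = b" "\<tau> = insert 0 (Suc ` \<rho>)"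
proof -
  have st: "finite \<sigma>" "card \<sigma> = b" using assms(1) by (auto simp: juggling_states_def)
  obtain r where r: "r \<in> insert None (Some ` {1..b})" "\<tau> = backward_step \<sigma> r"
    using assms(2) by (auto simp: set_pmf_first_tails)
  show thesis
  proof (cases r)
    case None
    then show ?thesis using r that(1) by (simp add: backward_step_def)
  next
    case (Some i)
    then have x: "ith_largest \<sigma> i \<in> \<sigma>"
      using r bij_betwE[OF bij_betw_ith_largest[OF st]] by auto
    then show ?thesis
      using r Some st that(2)[of "ith_largest \<sigma> i" "\<sigma> - {ith_largest \<sigma> i}"] card_Suc_Diff1[OF st(1) x]
      by (auto simp: backward_step_def insert_absorb)
  qed
qed

lemma backward_step_in_juggling_states:
  assumes "\<sigma> \<in> juggling_states b"
  shows "set_pmf (map_pmf (backward_step \<sigma>) (first_tails p b)) \<subseteq> juggling_states b"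
proof
  fix \<tau> assume "\<tau> \<in> set_pmf (map_pmf (backward_step \<sigma>) (first_tails p b))"
  with assms show "\<tau> \<in> juggling_states b"
  proof (cases rule: backward_step_cases)
    case 1
    then show ?thesis using assms by (auto simp: juggling_states_def card_image)
  next
    case (2 x \<rho>)
    then show ?thesis by (auto simp: juggling_states_def card_image)
  qed
qed

section \<open>The normalising constant\<close>

lemma has_sum_geometric: "((\<lambda>n::nat. x ^ n) has_sum (1 / (1 - x))) UNIV"
  if "0 \<le> x" "x < 1" for x :: real
  using that geometric_sums[of x] by (intro sums_nonneg_imp_has_sum) auto

text \<open>The minimum \<open>m\<close> is recovered by \<open>Min\<close>; translating it to 0
  leaves an occupied position 0 followed by an arbitrary state with one ball fewer.\<close>

lemma bij_betw_split_minimum: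
  "bij_betw (\<lambda>(m, \<rho>). (+) m ` insert 0 (Suc ` \<rho>))
     (UNIV \<times> juggling_states b) (juggling_states (Suc b))" (is "bij_betw ?f ?A ?B")
proof -
  have Min: "Min (?f (m, \<rho>)) = m" if "finite \<rho>" for m \<rho>
    using that by (intro Min_eqI) auto
  have inj: "inj_on ?f ?A"
  proof (rule inj_onI)
    fix y z assume y: "y \<in> ?A" and z: "z \<in> ?A" and eq: "?f y = ?f z"
    obtain m \<rho> n \<rho>' where yz: "y = (m, \<rho>)" "z = (n, \<rho>')" by (cases y, cases z)
    have "m = n"
      using y z eq Min[of \<rho> m] Min[of \<rho>' n] unfolding yz
      by (simp add: juggling_states_def del: image_insert)
    then have "insert 0 (Suc ` \<rho>) = insert 0 (Suc ` \<rho>')"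
      using eq unfolding yz by (simp add: inj_image_eq_iff del: image_insert)
    then have "\<rho> = \<rho>'" by (subst (asm) insert_ident) (auto simp: inj_image_eq_iff)
    with \<open>m = n\<close> yz show "y = z" by simp
  qed
  have "\<sigma> \<in> ?f ` ?A" if "\<sigma> \<in> ?B" for \<sigma>
  proof -
    have \<sigma>: "finite \<sigma>" "card \<sigma> = Suc b" "\<sigma> \<noteq> {}" using that by (auto simp: juggling_states_def)
    \<comment> \<open>Subtracting \<open>Suc m\<close> undoes both the translation and the inner
      \<open>Suc\<close>; by \<open>ge\<close> below, the subtraction never truncates.\<close>
    define m \<rho> where "m = Min \<sigma>" and "\<rho> = (\<lambda>s. s - Suc m) ` (\<sigma> - {m})"
    have m: "m \<in> \<sigma>" using \<sigma> by (simp add: m_def)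
    have ge: "Suc m \<le> s" if "s \<in> \<sigma> - {m}" for s
      using that Min_le[OF \<sigma>(1), of s] by (simp add: m_def)
    have "card \<rho> = b"
      unfolding \<rho>_def using m ge \<sigma> by (subst card_image) (auto simp: inj_on_def eq_diff_iff)
    then have "(m, \<rho>) \<in> ?A" using \<sigma> by (auto simp: juggling_states_def \<rho>_def)
    moreover have "(\<lambda>s. m + Suc (s - Suc m)) ` (\<sigma> - {m}) = (\<lambda>s. s) ` (\<sigma> - {m})"
      using ge by (intro image_cong) force+
    then have "?f (m, \<rho>) = \<sigma>"
      using m by (simp add: \<rho>_def image_image insert_absorb)
    ultimately show ?thesis by (metis image_eqI)
  qed
  moreover have "?f y \<in> ?B" if "y \<in> ?A" for y
    using that by (auto simp: juggling_states_def card_image card_insert_if simp flip: image_image)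
  ultimately show ?thesis using inj by (auto simp: bij_betw_def)
qed

lemma ell_add_image: "finite \<sigma> \<Longrightarrow> ell ((+) m ` \<sigma>) = ell \<sigma> + m * card \<sigma>"
proof (induction m)
  case (Suc m)
  have "(+) (Suc m) ` \<sigma> = Suc ` (+) m ` \<sigma>" by (simp add: image_image)
  with Suc show ?case by (simp add: ell_Suc_image card_image)
qed simp

text \<open>Induction through \<open>bij_betw_split_minimum\<close>: translating
  \<open>Suc b\<close> balls by \<open>m\<close> raises \<open>ell\<close> by
  \<open>m * Suc b\<close>, while the ball at 0 adds nothing. Summing over \<open>m\<close> is a
  geometric series of ratio \<open>p ^ Suc b\<close>, which supplies the new factor.\<close>

lemma has_sum_weights:
  "((\<lambda>\<tau>. p ^ ell \<tau>) has_sum (1 / (\<Prod>i=1..b. 1 - p ^ i))) (juggling_states b)"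
proof (induction b)
  case 0
  have "juggling_states 0 = {{}}" by (auto simp: juggling_states_def)
  then show ?case by (simp add: ell_def has_sum_finite_iff)
next
  case (Suc b)
  let ?Z = "1 / (\<Prod>i=1..b. 1 - p ^ i)"
  have q: "0 \<le> p ^ Suc b" "p ^ Suc b < 1"
    using p by (auto simp: power_less_one_iff simp del: power_Suc)
  have ell: "p ^ ell ((+) m ` insert 0 (Suc ` \<rho>)) = (p ^ Suc b) ^ m * p ^ ell \<rho>"
    if "\<rho> \<in> juggling_states b" for m \<rho>
    using that unfolding ell_add_image[of "insert 0 (Suc ` \<rho>)" m]
    by (subst ell_add_image)
      (auto simp: juggling_states_def ell_insert_0 card_image power_add power_mult[symmetric]
        mult.commute simp del: power_Suc image_insert)
  have "((\<lambda>(m, \<rho>). (p ^ Suc b) ^ m * p ^ ell \<rho>) has_sum (1 / (1 - p ^ Suc b) * ?Z))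
      (UNIV \<times> juggling_states b)"
  proof (rule has_sum_SigmaI)
    show "((\<lambda>\<rho>. case (m, \<rho>) of (m, \<rho>) \<Rightarrow> (p ^ Suc b) ^ m * p ^ ell \<rho>) has_sum ((p ^ Suc b) ^ m * ?Z))
        (juggling_states b)" for m
      using has_sum_cmult_right[OF Suc, of "(p ^ Suc b) ^ m"] by simp
    show geo: "((\<lambda>m. (p ^ Suc b) ^ m * ?Z) has_sum (1 / (1 - p ^ Suc b) * ?Z)) UNIV"
      using q by (intro has_sum_cmult_left has_sum_geometric)
    \<comment> \<open>The terms are nonnegative, so convergence of the iterated sums
      suffices.\<close>
    show "(\<lambda>(m, \<rho>). (p ^ Suc b) ^ m * p ^ ell \<rho>) summable_on (UNIV \<times> juggling_states b)"
      using p q has_sum_imp_summable[OF geo] has_sum_cmult_right[OF Suc]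
      by (intro summable_on_SigmaI[where g = "\<lambda>m. (p ^ Suc b) ^ m * ?Z"]) (auto simp del: power_Suc)
  qed
  then have "((\<lambda>\<tau>. p ^ ell \<tau>) has_sum (1 / (1 - p ^ Suc b) * ?Z)) (juggling_states (Suc b))"
    by (subst has_sum_reindex_bij_betw[OF bij_betw_split_minimum, symmetric],
        subst has_sum_cong) (auto simp: ell simp del: power_Suc image_insert)
  then show ?case by (simp add: mult.commute)
qed

section \<open>The balance equations\<close>

lemma balance_shift:
  assumes "\<sigma> \<in> juggling_states b"
  shows "((\<lambda>\<sigma>'. p ^ ell \<sigma>' * pmf (map_pmf (backward_step \<sigma>') (first_tails p b)) (Suc ` \<sigma>))
           has_sum p ^ ell (Suc ` \<sigma>)) (juggling_states b)" (is "(?g has_sum _) _")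
proof -
  \<comment> \<open>Any tails would put a ball at 0, and the shift is injective, so no other state
    leads here.\<close>
  have zero: "?g \<sigma>' = 0" if "\<sigma>' \<in> juggling_states b" "\<sigma>' \<noteq> \<sigma>" for \<sigma>'
  proof -
    have "Suc ` \<sigma> \<notin> set_pmf (map_pmf (backward_step \<sigma>') (first_tails p b))"
    proof
      assume "Suc ` \<sigma> \<in> set_pmf (map_pmf (backward_step \<sigma>') (first_tails p b))"
      with that(1) show False
        by (cases rule: backward_step_cases) (use that(2) in \<open>auto simp: inj_image_eq_iff\<close>)
    qed
    then show ?thesis by (simp only: set_pmf_iff not_not mult_zero_right)
  qed
  have "?g \<sigma> = p ^ ell (Suc ` \<sigma>)"
    using assms by (simp add: pmf_backward_shift ell_Suc_image power_add juggling_states_def)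
  then have "(?g has_sum p ^ ell (Suc ` \<sigma>)) {\<sigma>}"
    by (simp add: has_sum_finite_iff)
  then show ?thesis
    using assms zero by (subst has_sum_cong_neutral[where T = "{\<sigma>}" and g = ?g]) auto
qed

lemma balance_insert:
  assumes \<rho>: "finite \<rho>" "Suc (card \<rho>) = b"
  shows "((\<lambda>\<sigma>. p ^ ell \<sigma> * pmf (map_pmf (backward_step \<sigma>) (first_tails p b)) (insert 0 (Suc ` \<rho>)))
           has_sum p ^ ell \<rho>) (juggling_states b)" (is "(?g has_sum _) _")
proof -
  \<comment> \<open>Listing the gaps of \<open>\<rho>\<close> in increasing order puts exactly
    \<open>n\<close> gaps below \<open>e n\<close>, so the sum over predecessors becomes a sum over
    \<open>n\<close>.\<close>
  define e where "e = enumerate (- \<rho>)"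
  have inf: "infinite (- \<rho>)" using \<rho> by (simp add: finite_compl)
  have e: "bij_betw e UNIV (- \<rho>)" "strict_mono e"
    using inf by (auto simp: e_def bij_enumerate strict_mono_enumerate)
  have e_notin: "e n \<notin> \<rho>" for n using bij_betwE[OF e(1)] by auto
  have below: "card {i. i < e n \<and> i \<notin> \<rho>} = n" for n
  proof -
    have "{i. i < e n \<and> i \<notin> \<rho>} = e ` {..<n}"
    proof (intro equalityI subsetI)
      fix i assume i: "i \<in> {i. i < e n \<and> i \<notin> \<rho>}"
      then obtain k where "i = e k" using e(1) by (auto simp: bij_betw_def)
      with i show "i \<in> e ` {..<n}" using e(2) by (auto simp: strict_mono_less)
    qed (use e(2) e_notin in \<open>auto simp: strict_mono_less\<close>)
    moreover have "inj_on e {..<n}"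
      using e(1) by (auto simp: bij_betw_def intro: inj_on_subset)
    ultimately show ?thesis by (simp add: card_image)
  qed
  have summand: "?g (insert (e n) \<rho>) = p ^ n * ((1 - p) * p ^ ell \<rho>)" for n
  proof -
    have "p ^ ell (insert (e n) \<rho>) * p ^ card {s \<in> \<rho>. e n < s} = p ^ ell \<rho> * p ^ n"
      using ell_insert[OF \<rho>(1) e_notin, of n] by (simp only: below flip: power_add)
    then show ?thesis
      by (simp only: pmf_backward_insert[OF \<rho>(1) e_notin \<rho>(2)] ac_simps)
  qed
  have inj: "inj (\<lambda>n. insert (e n) \<rho>)"
  proof (rule injI)
    fix m n assume "insert (e m) \<rho> = insert (e n) \<rho>"
    then have "e m = e n" using e_notin by blast
    then show "m = n" using e(2) by (simp add: strict_mono_eq)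
  qed
  \<comment> \<open>The sum \<open>1 / (1 - p)\<close> cancels the probability \<open>1 - p\<close>
    of the final tails.\<close>
  have "((\<lambda>n. p ^ n * ((1 - p) * p ^ ell \<rho>)) has_sum (1 / (1 - p) * ((1 - p) * p ^ ell \<rho>))) UNIV"
    using p by (intro has_sum_cmult_left has_sum_geometric) auto
  then have "((\<lambda>n. ?g (insert (e n) \<rho>)) has_sum p ^ ell \<rho>) UNIV"
    using p by (simp add: summand)
  then have img: "(?g has_sum p ^ ell \<rho>) (range (\<lambda>n. insert (e n) \<rho>))"
    using has_sum_reindex[OF inj, of ?g "p ^ ell \<rho>"] by (simp add: o_def)
  have sub: "range (\<lambda>n. insert (e n) \<rho>) \<subseteq> juggling_states b"
    using \<rho> e_notin by (auto simp: juggling_states_def)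
  \<comment> \<open>A run of heads leaves 0 empty; otherwise cancelling 0 and the shift identifies
    the remaining set with \<open>\<rho>\<close>, so the removed element is a gap
    \<open>e n\<close>.\<close>
  have zero: "?g \<sigma> = 0" if \<sigma>: "\<sigma> \<in> juggling_states b" "\<sigma> \<notin> range (\<lambda>n. insert (e n) \<rho>)" for \<sigma>
  proof -
    have "insert 0 (Suc ` \<rho>) \<notin> set_pmf (map_pmf (backward_step \<sigma>) (first_tails p b))"
    proof
      assume "insert 0 (Suc ` \<rho>) \<in> set_pmf (map_pmf (backward_step \<sigma>) (first_tails p b))"
      with \<sigma>(1) show False
      proof (cases rule: backward_step_cases)
        case 1
        then show False by auto
      next
        case (2 x \<rho>')
        then have "\<rho> = \<rho>'" by (subst (asm) insert_ident) (auto simp: inj_image_eq_iff)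
        moreover from this 2 obtain n where "x = e n"
          using e(1) by (auto simp: bij_betw_def)
        ultimately show False using \<sigma>(2) 2 by auto
      qed
    qed
    then show ?thesis by (simp only: set_pmf_iff not_not mult_zero_right)
  qed
  show ?thesis
    using img sub zero
    by (subst has_sum_cong_neutral[where T = "range (\<lambda>n. insert (e n) \<rho>)" and g = ?g]) auto
qed

lemma balance:
  assumes "\<tau> \<in> juggling_states b"
  shows "((\<lambda>\<sigma>. p ^ ell \<sigma> * pmf (map_pmf (backward_step \<sigma>) (first_tails p b)) \<tau>)
           has_sum p ^ ell \<tau>) (juggling_states b)"
proof -
  \<comment> \<open>Deleting position 0 and shifting down exposes the form of \<open>\<tau>\<close>;
    whether 0 is occupied selects the balance lemma.\<close>
  define \<rho> where "\<rho> = {s. Suc s \<in> \<tau>}"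
  have im: "Suc ` \<rho> = \<tau> - {0}"
    by (auto simp: \<rho>_def image_iff) (metis not0_implies_Suc)
  have fin: "finite \<tau>" "card \<tau> = b" using assms by (auto simp: juggling_states_def)
  then have fin': "finite \<rho>" using im by (metis finite_Diff finite_imageD inj_Suc)
  have card: "card \<rho> = card (\<tau> - {0})" by (simp add: card_image flip: im)
  show ?thesis
  proof (cases "0 \<in> \<tau>")
    case True
    then have \<tau>: "\<tau> = insert 0 (Suc ` \<rho>)" by (auto simp: im)
    have "Suc (card \<rho>) = b" using card_Suc_Diff1[OF fin(1) True] fin card by simp
    from balance_insert[OF fin' this] show ?thesis by (simp only: \<tau> ell_insert_0)
  next
    case False
    then have \<tau>: "\<tau> = Suc ` \<rho>" by (auto simp: im)
    have "\<rho> \<in> juggling_states b" using fin fin' card False by (simp add: juggling_states_def)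
    from balance_shift[OF this] show ?thesis by (simp only: \<tau>)
  qed
qed

end

theorem theorem2p4:
  fixes q :: real and b :: nat
  assumes "q > 1" and "b \<ge> 1"
  shows "stationary_distribution_on (juggling_states b) (backward_chain q b)
           (\<lambda>\<tau>. (\<Prod>i=1..b. 1 - 1 / q ^ i) * (1 / q ^ ell \<tau>))"
proof -
  define p where "p = 1 / q"
  have p: "0 < p" "p < 1" using assms by (auto simp: p_def)
  define C where "C = (\<Prod>i=1..b. 1 - p ^ i)"
  \<comment> \<open>Indices start at 1, so each factor is positive; \<open>C\<close> can then cancel
    the reciprocal in \<open>has_sum_weights\<close>.\<close>
  have C: "C > 0"
    unfolding C_def using p by (intro prod_pos) (auto simp: power_less_one_iff)
  have weight: "(\<Prod>i=1..b. 1 - 1 / q ^ i) * (1 / q ^ ell \<tau>) = C * p ^ ell \<tau>" for \<tau>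
    by (simp add: C_def p_def power_one_over)
  have chain: "backward_chain q b \<sigma> = map_pmf (backward_step \<sigma>) (first_tails p b)" for \<sigma>
    by (simp add: backward_chain_def p_def)
  show ?thesis
    unfolding stationary_distribution_on_def weight chain
  proof (intro conjI ballI)
    fix \<sigma> assume "\<sigma> \<in> juggling_states b"
    then show "set_pmf (map_pmf (backward_step \<sigma>) (first_tails p b)) \<subseteq> juggling_states b"
      using p by (intro backward_step_in_juggling_states)
    show "0 \<le> C * p ^ ell \<sigma>" using C p by simp
    show "((\<lambda>\<sigma>'. C * p ^ ell \<sigma>' * pmf (map_pmf (backward_step \<sigma>') (first_tails p b)) \<sigma>)
        has_sum C * p ^ ell \<sigma>) (juggling_states b)"
      using has_sum_cmult_right[OF balance[OF p \<open>\<sigma> \<in> _\<close>], of C] by (simp add: mult.assoc)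
  next
    show "((\<lambda>\<tau>. C * p ^ ell \<tau>) has_sum 1) (juggling_states b)"
      using has_sum_cmult_right[OF has_sum_weights[OF p, of b], of C] C
      unfolding C_def[symmetric] by simp
  qed
qed

end
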